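(* Let $p,q$ be primes and $a,b$ positive integers. Consider the equation $\binom{p^a}{i}-\binom{q^b}{j}=1$, where the binomial coefficients are required to be positive, i.e. $p^a\ge i$ and $q^b\ge j$. (1) For $(i,j)=(2,1)$, i.e. $\binom{p^a}{2}-q^b=1$, the solutions are exactly $(p,q,a,b)=(2,5,2,1),(3,2,1,1),(2,3,3,3),(5,3,1,2)$. (2) For $(i,j)=(3,1)$, i.e. $\binom{p^a}{3}-q^b=1$, the solutions are exactly $(p,q,a,b)=(2,3,2,1),(3,83,2,1),(5,3,1,2)$. (3) For $(i,j)=(4,1)$, i.e. $\binom{p^a}{4}-q^b=1$, the solutions are exactly $(p,q,a,b)=(5,2,1,2),(3,5,2,3)$.
   Context: A figurate prime is a positive binomial coefficient $\binom{p^a}{i}$ with $p$ prime and $a,i\ge 1$ integers. *)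

theory Defs
  imports "HOL-Computational_Algebra.Primes"
begin

text \<open>
  Solutions \<open>(p, q, a, b)\<close> of \<open>binom(p^a, i) - binom(q^b, j) = 1\<close>. The difference is taken in
  the integers, and \<open>i \<le> p ^ a\<close>, \<open>j \<le> q ^ b\<close> express positivity of the binomial coefficients.
\<close>
definition figurate_solutions :: "nat \<Rightarrow> nat \<Rightarrow> (nat \<times> nat \<times> nat \<times> nat) set" where
  "figurate_solutions i j =
     {(p, q, a, b). prime p \<and> prime q \<and> 0 < a \<and> 0 < b \<and> i \<le> p ^ a \<and> j \<le> q ^ b \<and>
        int (p ^ a choose i) - int (q ^ b choose j) = 1}"

end

theory Submission
  imports Defs
begin

text \<open>
  In all three cases \<open>c (binom(n, i) - 1)\<close> with \<open>c = i!\<close> factors as \<open>A B\<close> where \<open>gcd A B\<close> divides a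
  constant \<open>g\<close>. If \<open>A B = c q^b\<close>, the factor with fewer factors \<open>q\<close> must divide \<open>c g\<close>, which
  leaves finitely many \<open>n\<close>. Putting \<open>n = k + i\<close>, the factorizations are \<open>k (k + 3)\<close>,
  \<open>k (k\<^sup>2 + 6 k + 11)\<close> and \<open>k (k + 5) (k (k + 5) + 10)\<close>, with \<open>g = 3, 11, 10\<close>.
\<close>

text \<open>Write \<open>A = q ^ x * A'\<close> with \<open>A'\<close> prime to \<open>q\<close>.
  Since \<open>q ^ x\<close> divides both factors, it divides their gcd and hence \<open>g\<close>;
  since \<open>A'\<close> is coprime to \<open>q ^ b\<close>, it divides \<open>c\<close>.\<close>

lemma dvd_mult_of_dvd_mult_prime_power:
  fixes A B c g q b :: nat
  assumes q: "prime q" and eq: "A * B = c * q ^ b" and A: "A > 0" and g: "gcd A B dvd g"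
    and le: "multiplicity q A \<le> multiplicity q B"
  shows "A dvd c * g"
proof -
  define x where "x = multiplicity q A"
  obtain A' where A': "A = q ^ x * A'" "\<not> q dvd A'"
    using multiplicity_decompose'[of A q] A q unfolding x_def
    by (metis not_prime_unit not_gr_zero)
  have "q ^ x dvd A" "q ^ x dvd B"
    using le unfolding x_def by (auto intro: multiplicity_dvd multiplicity_dvd')
  hence "q ^ x dvd g" using g by (meson dvd_trans gcd_greatest)
  moreover have "A' dvd c * q ^ b"
    unfolding eq[symmetric] A' by simp
  moreover have "coprime A' (q ^ b)"
    using q A'(2) by (metis coprime_commute coprime_power_right_iff prime_imp_coprime)
  ultimately have "A' dvd c" "q ^ x dvd g"
    by (auto simp: coprime_dvd_mult_left_iff)
  thus ?thesis unfolding A' by (metis mult.commute mult_dvd_mono)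
qed

text \<open>Writing the second factor as \<open>m * A + g\<close> bounds the gcd by
  \<open>g\<close>. The previous lemma then applies to whichever factor has the smaller multiplicity
  of \<open>q\<close>.\<close>

lemma factor_dvd_of_mult_eq_prime_power:
  fixes A m g c q b :: nat
  assumes "prime q" "A * (m * A + g) = c * q ^ b" "c > 0"
  shows "A dvd c * g \<or> m * A + g dvd c * g"
proof -
  have "A * (m * A + g) > 0" using assms by (simp add: prime_gt_0_nat)
  hence pos: "A > 0" "m * A + g > 0" by auto
  have gcd: "gcd A (m * A + g) dvd g"
    by (metis dvd_add_right_iff dvd_mult gcd_dvd1 gcd_dvd2)
  show ?thesis
  proof (cases "multiplicity q A \<le> multiplicity q (m * A + g)")
    case True
    thus ?thesis using dvd_mult_of_dvd_mult_prime_power[OF assms(1,2) pos(1) gcd] by blast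
  next
    case False
    thus ?thesis
      using dvd_mult_of_dvd_mult_prime_power[OF assms(1), of "m * A + g" A c b g] assms(2) pos gcd
      by (simp add: mult.commute gcd.commute)
  qed
qed

text \<open>Discards candidate values of \<open>q ^ b\<close> that have two distinct prime
  divisors.\<close>

lemma prime_power_prime_divisor_unique:
  fixes q r s b :: nat
  assumes "prime q" "q ^ b = N" "prime r" "prime s" "r dvd N" "s dvd N"
  shows "r = s"
  using assms by (metis prime_dvd_power primes_dvd_imp_eq)

lemma choose_two_add: "2 * ((k + 2) choose 2) = (k + 1) * (k + 2)" for k :: nat
  by (induction k) (simp_all add: numeral_eq_Suc algebra_simps)

lemma choose_three_add: "6 * ((k + 3) choose 3) = (k + 1) * (k + 2) * (k + 3)" for k :: nat
proof (induction k)
  case (Suc k)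
  have "(Suc k + 3) choose 3 = ((k + 3) choose 3) + ((k + 1 + 2) choose 2)"
    by (simp add: numeral_eq_Suc)
  thus ?case using Suc choose_two_add[of "k + 1"] by (simp add: algebra_simps)
qed simp

lemma choose_four_add: "24 * ((k + 4) choose 4) = (k + 1) * (k + 2) * (k + 3) * (k + 4)" for k :: nat
proof (induction k)
  case (Suc k)
  have "(Suc k + 4) choose 4 = ((k + 4) choose 4) + ((k + 1 + 3) choose 3)"
    by (simp add: numeral_eq_Suc)
  thus ?case using Suc choose_three_add[of "k + 1"] by (simp add: algebra_simps)
qed simp

lemma choose_two_eq_Suc_prime_power:
  assumes q: "prime q" and eq: "(n choose 2) = q ^ b + 1" and n: "2 \<le> n"
  shows "(n, q ^ b) \<in> {(3, 2), (4, 5), (5, 9), (8, 27)}"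
proof -
  obtain k where k: "n = k + 2" using n by (metis add.commute le_iff_add)
  have *: "k * (1 * k + 3) = 2 * q ^ b"
    using choose_two_add[of k] eq unfolding k by (simp add: algebra_simps)
  from factor_dvd_of_mult_eq_prime_power[OF q this]
  have "k dvd 6 \<or> k + 3 dvd 6" by simp
  moreover from this have "k \<le> 6" by (auto dest!: dvd_imp_le)
  hence "k \<in> {0,1,2,3,4,5,6}" by auto
  moreover have "q ^ b > 0" using q by (simp add: prime_gt_0_nat)
  ultimately show ?thesis using * k by auto
qed

text \<open>Here \<open>n\<close> need not be a prime power, so the list contains
  \<open>(6, 19)\<close>, from 20 = 19 + 1. This pair disappears once
  \<open>n = p ^ a\<close>.\<close>

lemma choose_three_eq_Suc_prime_power:
  assumes q: "prime q" and eq: "(n choose 3) = q ^ b + 1" and n: "3 \<le> n"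
  shows "(n, q ^ b) \<in> {(4, 3), (5, 9), (6, 19), (9, 83)}"
proof -
  obtain k where k: "n = k + 3" using n by (metis add.commute le_iff_add)
  have *: "k * ((k + 6) * k + 11) = 6 * q ^ b"
    using choose_three_add[of k] eq unfolding k by (simp add: algebra_simps)
  from factor_dvd_of_mult_eq_prime_power[OF q this]
  have dvd: "k dvd 66 \<or> (k + 6) * k + 11 dvd 66" by simp
  \<comment> \<open>These are the divisors of 66 = 6 * 11 together with 5, the only positive
    \<open>k\<close> for which just the quadratic factor divides 66: at \<open>k = 5\<close> it
    equals 66.\<close>
  have "k \<in> {1,2,3,5,6,11,22,33,66}"
  proof (cases "k dvd 66")
    case True
    hence "k \<in> {..66}" by (auto dest: dvd_imp_le)
    moreover have "\<forall>d\<in>{..66::nat}. d dvd 66 \<longrightarrow> d \<in> {1,2,3,6,11,22,33,66}"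
      by (simp add: atMost_nat_numeral atMost_Suc)
    ultimately show ?thesis using True by auto
  next
    case False
    with dvd have B: "(k + 6) * k + 11 dvd 66" by simp
    have "\<not> k \<ge> 6"
    proof
      assume "k \<ge> 6"
      hence "(k + 6) * k \<ge> 12 * 6" by (intro mult_mono) auto
      with dvd_imp_le[OF B] show False by simp
    qed
    hence "k \<in> {0,1,2,3,4,5}" by auto
    moreover have "k \<noteq> 0" using * q by (intro notI) auto
    ultimately show ?thesis using B by auto
  qed
  \<comment> \<open>For \<open>k\<close> = 5, 11, 22, 33, 66 the equation forces the values of
    \<open>q ^ b\<close> listed below, each with two distinct prime divisors. The other
    \<open>k\<close>, namely 1, 2, 3, 6, give the pairs claimed.\<close>
  moreover have "q ^ b \<noteq> N" if "prime r" "prime s" "r dvd N" "s dvd N" "r \<noteq> s" for N r s :: nat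
    using prime_power_prime_divisor_unique[OF q _ that(1-4)] that(5) by blast
  note this[of 5 11 55] this[of 3 11 363] this[of 11 19 2299] this[of 11 59 7139] this[of 11 433 52393]
  ultimately show ?thesis using * k by auto
qed

lemma choose_four_eq_Suc_prime_power:
  assumes q: "prime q" and eq: "(n choose 4) = q ^ b + 1" and n: "4 \<le> n"
  shows "(n, q ^ b) \<in> {(5, 4), (9, 125)}"
proof -
  obtain k where k: "n = k + 4" using n by (metis add.commute le_iff_add)
  \<comment> \<open>With t = k(k + 5), pairing outer and inner factors gives (k + 1)(k + 4) = t + 4
    and (k + 2)(k + 3) = t + 6, and (t + 4)(t + 6) - 24 = t(t + 10).\<close>
  have *: "(k * (k + 5)) * (1 * (k * (k + 5)) + 10) = 24 * q ^ b"
    using choose_four_add[of k] eq unfolding k by (simp add: algebra_simps)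
  from factor_dvd_of_mult_eq_prime_power[OF q this]
  have dvd: "k * (k + 5) dvd 240 \<or> k * (k + 5) + 10 dvd 240" by simp
  hence le: "k * (k + 5) \<le> 240" by (auto dest!: dvd_imp_le)
  \<comment> \<open>14 is the least \<open>k\<close> with k(k + 5) > 240.\<close>
  have "\<not> k \<ge> 14"
  proof
    assume "k \<ge> 14"
    hence "k * (k + 5) \<ge> 14 * 19" by (intro mult_mono) auto
    with le show False by simp
  qed
  hence "k \<in> {..13}" by simp
  moreover have "\<forall>k\<in>{..13::nat}. k * (k + 5) dvd 240 \<or> k * (k + 5) + 10 dvd 240 \<longrightarrow>
      k \<in> {0,1,2,3,5}"
    by (simp add: atMost_nat_numeral atMost_Suc)
  ultimately have "k \<in> {0,1,2,3,5}" using dvd by blast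
  \<comment> \<open>\<open>k = 2\<close> and \<open>k = 3\<close> would give 14 and 34;
    \<open>k = 0\<close> would give \<open>q ^ b = 0\<close>.\<close>
  moreover have "q ^ b \<noteq> N" if "prime r" "prime s" "r dvd N" "s dvd N" "r \<noteq> s" for N r s :: nat
    using prime_power_prime_divisor_unique[OF q _ that(1-4)] that(5) by blast
  note this[of 2 7 14] this[of 2 17 34]
  moreover have "q ^ b > 0" using q by (simp add: prime_gt_0_nat)
  ultimately show ?thesis using * k by auto
qed

lemma figurate_solutions_one:
  "(p, q, a, b) \<in> figurate_solutions i 1 \<longleftrightarrow>
    prime p \<and> prime q \<and> 0 < a \<and> 0 < b \<and> i \<le> p ^ a \<and> (p ^ a choose i) = q ^ b + 1"
proof -
  have "int x - int y = 1 \<longleftrightarrow> x = y + 1" for x y by linarith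
  thus ?thesis
    by (auto simp: figurate_solutions_def prime_gt_0_nat Suc_le_eq simp del: of_nat_power)
qed

text \<open>Unique factorization turns the candidate values of \<open>p ^ a\<close> and
  \<open>q ^ b\<close> into exponents; \<open>p ^ a \<noteq> 6\<close> removes the pair
  \<open>(6, 19)\<close>.\<close>

lemma prime_power_numeral_cases:
  fixes p a :: nat
  assumes "prime p" "0 < a"
  shows "p ^ a = 2 \<longleftrightarrow> p = 2 \<and> a = 1" "p ^ a = 3 \<longleftrightarrow> p = 3 \<and> a = 1"
    "p ^ a = 4 \<longleftrightarrow> p = 2 \<and> a = 2" "p ^ a = 5 \<longleftrightarrow> p = 5 \<and> a = 1"
    "p ^ a = 8 \<longleftrightarrow> p = 2 \<and> a = 3" "p ^ a = 9 \<longleftrightarrow> p = 3 \<and> a = 2"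
    "p ^ a = 27 \<longleftrightarrow> p = 3 \<and> a = 3" "p ^ a = 83 \<longleftrightarrow> p = 83 \<and> a = 1"
    "p ^ a = 125 \<longleftrightarrow> p = 5 \<and> a = 3" "p ^ a \<noteq> 6"
proof -
  have eq: "p ^ a = r ^ k \<longleftrightarrow> p = r \<and> a = k" if "prime r" for r k :: nat
    using prime_power_inj''[OF assms(1) that] assms(2) by auto
  show "p ^ a = 2 \<longleftrightarrow> p = 2 \<and> a = 1" using eq[of 2 1] by simp
  show "p ^ a = 3 \<longleftrightarrow> p = 3 \<and> a = 1" using eq[of 3 1] by simp
  show "p ^ a = 4 \<longleftrightarrow> p = 2 \<and> a = 2" using eq[of 2 2] by simp
  show "p ^ a = 5 \<longleftrightarrow> p = 5 \<and> a = 1" using eq[of 5 1] by simp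
  show "p ^ a = 8 \<longleftrightarrow> p = 2 \<and> a = 3" using eq[of 2 3] by simp
  show "p ^ a = 9 \<longleftrightarrow> p = 3 \<and> a = 2" using eq[of 3 2] by simp
  show "p ^ a = 27 \<longleftrightarrow> p = 3 \<and> a = 3" using eq[of 3 3] by simp
  show "p ^ a = 83 \<longleftrightarrow> p = 83 \<and> a = 1" using eq[of 83 1] by simp
  show "p ^ a = 125 \<longleftrightarrow> p = 5 \<and> a = 3" using eq[of 5 3] by simp
  show "p ^ a \<noteq> 6"
    using prime_power_prime_divisor_unique[OF assms(1), of a 6 2 3] by auto
qed

theorem theorem1p1:
  shows "figurate_solutions 2 1 = {(2, 5, 2, 1), (3, 2, 1, 1), (2, 3, 3, 3), (5, 3, 1, 2)} \<and>
    figurate_solutions 3 1 = {(2, 3, 2, 1), (3, 83, 2, 1), (5, 3, 1, 2)} \<and>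
    figurate_solutions 4 1 = {(5, 2, 1, 2), (3, 5, 2, 3)}"
proof (intro conjI equalityI subsetI)
  fix x assume x: "x \<in> figurate_solutions 2 1"
  obtain p q a b where [simp]: "x = (p, q, a, b)" by (cases x)
  from x have *: "prime p" "prime q" "0 < a" "0 < b" "2 \<le> p ^ a" "(p ^ a choose 2) = q ^ b + 1"
    by (simp_all only: figurate_solutions_one \<open>x = _\<close>)
  from choose_two_eq_Suc_prime_power[OF *(2,6,5)]
  show "x \<in> {(2, 5, 2, 1), (3, 2, 1, 1), (2, 3, 3, 3), (5, 3, 1, 2)}"
    by (auto simp: prime_power_numeral_cases[OF *(1,3)] prime_power_numeral_cases[OF *(2,4)])
next
  fix x assume x: "x \<in> figurate_solutions 3 1"
  obtain p q a b where [simp]: "x = (p, q, a, b)" by (cases x)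
  from x have *: "prime p" "prime q" "0 < a" "0 < b" "3 \<le> p ^ a" "(p ^ a choose 3) = q ^ b + 1"
    by (simp_all only: figurate_solutions_one \<open>x = _\<close>)
  from choose_three_eq_Suc_prime_power[OF *(2,6,5)]
  show "x \<in> {(2, 3, 2, 1), (3, 83, 2, 1), (5, 3, 1, 2)}"
    by (auto simp: prime_power_numeral_cases[OF *(1,3)] prime_power_numeral_cases[OF *(2,4)])
next
  fix x assume x: "x \<in> figurate_solutions 4 1"
  obtain p q a b where [simp]: "x = (p, q, a, b)" by (cases x)
  from x have *: "prime p" "prime q" "0 < a" "0 < b" "4 \<le> p ^ a" "(p ^ a choose 4) = q ^ b + 1"
    by (simp_all only: figurate_solutions_one \<open>x = _\<close>)
  from choose_four_eq_Suc_prime_power[OF *(2,6,5)]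
  show "x \<in> {(5, 2, 1, 2), (3, 5, 2, 3)}"
    by (auto simp: prime_power_numeral_cases[OF *(1,3)] prime_power_numeral_cases[OF *(2,4)])
\<comment> \<open>The converse inclusions remain. The instances evaluate the binomials at n = 4, 5,
  9 for i = 3 and at n = 5, 9 for i = 4.\<close>
qed (use choose_three_add[of 1] choose_three_add[of 2] choose_three_add[of 6]
      choose_four_add[of 1] choose_four_add[of 5] in
    \<open>auto simp: figurate_solutions_def choose_two\<close>)

end
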